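(* Let $X$ and $Y$ be locally compact Hausdorff spaces and let $T\in\mathcal{L}^{r}(C_{0}(X),C_{0}(Y))$ be a separating operator. Then $T$ is almost contractive.
   Context: All vector lattices are real and all operators are linear. $C_0(X)$ is the semiprime $f$-algebra of real-valued continuous functions on $X$ vanishing at infinity, with pointwise operations and order. For a semiprime $f$-algebra $B$, $\mathrm{Orth}(B)$ is the unital $f$-algebra of all orthomorphisms on $B$ with unit the identity operator $I_B$, and $B$ is embedded in $\mathrm{Orth}(B)$ by identifying $f\in B$ with the multiplication operator $g\mapsto fg$. For $B=C_0(Y)$, $\mathrm{Orth}(B)$ is identified with the algebra $C_b(Y)$ of bounded continuous real-valued functions on $Y$. For semiprime $f$-algebras $A,B$, $\mathcal{L}^{r}(A,B)$ is the space of regular operators $A\to B$ (differences of two positive operators). $T\in\mathcal{L}^{r}(A,B)$ is separating if $T(f)T(g)=0$ whenever $fg=0$. Let $U_A=\{f\in A:0\le f\le I_A\}$; for $A=C_0(X)$ this is $\{f\in C_0(X):0\le f\le 1\}$. $T\in\mathcal{L}^{r}(A,B)$ is almost contractive if there exists $\omega\in\mathrm{Orth}(B)$ with $|Tf|\le\omega$ for all $f\in U_A$. *)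

theory Defs
  imports "HOL-Analysis.Analysis" "HOL-Library.Function_Algebras"
begin

(* The f-algebras A, B below are carrier sets of real-valued functions, closed under the
   pointwise operations: +, *, 0 come from Function_Algebras, and the order, inf and sup are
   the pointwise ones of the function type.  Operators are only constrained on the carrier. *)

(* Elements of C_0(X) are represented by functions that are 0 off topspace X, so that the
   pointwise operations and order of the function type are those of C_0(X). *)
definition C0 :: "'a topology \<Rightarrow> ('a \<Rightarrow> real) set" where
  "C0 X = {f. continuous_map X euclideanreal f \<and>
              (\<forall>e>0. compactin X {x \<in> topspace X. e \<le> \<bar>f x\<bar>}) \<and>
              (\<forall>x. x \<notin> topspace X \<longrightarrow> f x = 0)}"

definition modulus :: "('a \<Rightarrow> real) \<Rightarrow> 'a \<Rightarrow> real" where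
  "modulus f = sup f (- f)"

lemma modulus_apply: "modulus f x = \<bar>f x\<bar>"
  by (simp add: modulus_def sup_real_def)

definition linear_operator ::
  "('a \<Rightarrow> real) set \<Rightarrow> ('b \<Rightarrow> real) set \<Rightarrow> (('a \<Rightarrow> real) \<Rightarrow> 'b \<Rightarrow> real) \<Rightarrow> bool" where
  "linear_operator A B T \<longleftrightarrow>
     (\<forall>f\<in>A. T f \<in> B) \<and>
     (\<forall>f\<in>A. \<forall>g\<in>A. T (f + g) = T f + T g) \<and>
     (\<forall>c. \<forall>f\<in>A. T (\<lambda>x. c * f x) = (\<lambda>y. c * T f y))"

definition positive_operator ::
  "('a \<Rightarrow> real) set \<Rightarrow> ('b \<Rightarrow> real) set \<Rightarrow> (('a \<Rightarrow> real) \<Rightarrow> 'b \<Rightarrow> real) \<Rightarrow> bool" where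
  "positive_operator A B T \<longleftrightarrow> linear_operator A B T \<and> (\<forall>f\<in>A. 0 \<le> f \<longrightarrow> 0 \<le> T f)"

definition regular_operators ::
  "('a \<Rightarrow> real) set \<Rightarrow> ('b \<Rightarrow> real) set \<Rightarrow> (('a \<Rightarrow> real) \<Rightarrow> 'b \<Rightarrow> real) set" where
  "regular_operators A B =
     {T. linear_operator A B T \<and>
         (\<exists>P Q. positive_operator A B P \<and> positive_operator A B Q \<and> (\<forall>f\<in>A. T f = P f - Q f))}"

definition separating ::
  "('a \<Rightarrow> real) set \<Rightarrow> (('a \<Rightarrow> real) \<Rightarrow> 'b \<Rightarrow> real) \<Rightarrow> bool" where
  "separating A T \<longleftrightarrow> (\<forall>f\<in>A. \<forall>g\<in>A. f * g = 0 \<longrightarrow> T f * T g = 0)"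

definition order_bounded_operator ::
  "('a \<Rightarrow> real) set \<Rightarrow> ('b \<Rightarrow> real) set \<Rightarrow> (('a \<Rightarrow> real) \<Rightarrow> 'b \<Rightarrow> real) \<Rightarrow> bool" where
  "order_bounded_operator A B T \<longleftrightarrow> linear_operator A B T \<and>
     (\<forall>a\<in>A. \<forall>b\<in>A. \<exists>c\<in>B. \<exists>d\<in>B. \<forall>f\<in>A. a \<le> f \<and> f \<le> b \<longrightarrow> c \<le> T f \<and> T f \<le> d)"

(* Orthomorphisms: order bounded operators that preserve bands, i.e. such that
   f \<bottom> g implies \<pi> f \<bottom> g. *)
definition Orth :: "('a \<Rightarrow> real) set \<Rightarrow> (('a \<Rightarrow> real) \<Rightarrow> 'a \<Rightarrow> real) set" where
  "Orth A = {\<pi>. order_bounded_operator A A \<pi> \<and>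
      (\<forall>f\<in>A. \<forall>g\<in>A. inf (modulus f) (modulus g) = 0 \<longrightarrow> inf (modulus (\<pi> f)) (modulus g) = 0)}"

definition orth_le ::
  "('a \<Rightarrow> real) set \<Rightarrow> (('a \<Rightarrow> real) \<Rightarrow> 'a \<Rightarrow> real) \<Rightarrow> (('a \<Rightarrow> real) \<Rightarrow> 'a \<Rightarrow> real) \<Rightarrow> bool" where
  "orth_le A \<pi> \<rho> \<longleftrightarrow> (\<forall>g\<in>A. 0 \<le> g \<longrightarrow> \<pi> g \<le> \<rho> g)"

(* In the next two definitions f in A is identified with the operator of multiplication by f
   in Orth A; id is the unit of Orth A. *)
definition unit_part :: "('a \<Rightarrow> real) set \<Rightarrow> ('a \<Rightarrow> real) set" where
  "unit_part A = {f \<in> A. 0 \<le> f \<and> orth_le A ((*) f) id}"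

definition almost_contractive ::
  "('a \<Rightarrow> real) set \<Rightarrow> ('b \<Rightarrow> real) set \<Rightarrow> (('a \<Rightarrow> real) \<Rightarrow> 'b \<Rightarrow> real) \<Rightarrow> bool" where
  "almost_contractive A B T \<longleftrightarrow>
     (\<exists>\<omega>\<in>Orth B. \<forall>f\<in>unit_part A. orth_le B ((*) (modulus (T f))) \<omega>)"

lemma unit_part_C0: "unit_part (C0 X) = {f \<in> C0 X. 0 \<le> f \<and> f \<le> 1}"
proof -
  have "orth_le (C0 X) ((*) f) id \<longleftrightarrow> f \<le> 1" if f: "f \<in> C0 X" "0 \<le> f" for f
  proof
    assume "orth_le (C0 X) ((*) f) id"
    then have sq: "f x * f x \<le> f x" for x
      using f by (auto simp: orth_le_def le_fun_def)
    have "f x \<le> 1" for x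
      using sq[of x] f(2) by (cases "f x = 0") (auto simp: le_fun_def order_less_le)
    then show "f \<le> 1" by (simp add: le_fun_def)
  next
    assume "f \<le> 1"
    then have "f x * g x \<le> g x" if "0 \<le> g" for g x
      using that f(2) mult_right_mono[of "f x" 1 "g x"] by (simp add: le_fun_def)
    then show "orth_le (C0 X) ((*) f) id"
      by (simp add: orth_le_def le_fun_def)
  qed
  then show ?thesis by (auto simp: unit_part_def)
qed

end

theory Submission
  imports Defs
begin

text \<open>A regular operator on \<open>C\<^sub>0\<close> is automatically bounded on the unit
  part.  If a positive \<open>P\<close> were unbounded there, choose \<open>0 \<le> f\<^sub>n \<le> 1\<close> and \<open>y\<^sub>n\<close> with
  \<open>P f\<^sub>n (y\<^sub>n) > 4\<^sup>n\<close>; then \<open>f = \<Sum>n. 2\<^sup>-\<^sup>n f\<^sub>n\<close> lies in \<open>C\<^sub>0\<close> and positivity gives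
  \<open>P f (y\<^sub>n) > 2\<^sup>n\<close>, although \<open>P f\<close> is bounded.  Hence a multiple of the identity serves
  as the dominating orthomorphism.\<close>

text \<open>By continuity the sets where |f| >= e are closed, and a closed set inside a compact one
  is compact. Covering them by compact sets is easier to check for sums, multiples and
  limits.\<close>

lemma C0_I:
  assumes "continuous_map X euclideanreal f"
    and "\<And>e. 0 < e \<Longrightarrow> \<exists>K. compactin X K \<and> {x \<in> topspace X. e \<le> \<bar>f x\<bar>} \<subseteq> K"
    and "\<And>x. x \<notin> topspace X \<Longrightarrow> f x = 0"
  shows "f \<in> C0 X"
proof -
  have "compactin X {x \<in> topspace X. e \<le> \<bar>f x\<bar>}" if e: "0 < e" for e
  proof -
    obtain K where K: "compactin X K" "{x \<in> topspace X. e \<le> \<bar>f x\<bar>} \<subseteq> K"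
      using assms(2)[OF e] by blast
    have "continuous_map X euclideanreal (\<lambda>x. \<bar>f x\<bar>)"
      using assms(1) by (rule continuous_map_real_abs)
    then have "closedin X {x \<in> topspace X. \<bar>f x\<bar> \<in> {e..}}"
      by (rule closedin_continuous_map_preimage) simp
    with K show ?thesis by (simp add: closed_compactin)
  qed
  then show ?thesis using assms(1,3) by (simp add: C0_def)
qed

lemma C0_compactin: "f \<in> C0 X \<Longrightarrow> 0 < e \<Longrightarrow> compactin X {x \<in> topspace X. e \<le> \<bar>f x\<bar>}"
  by (simp add: C0_def)

lemma zero_in_C0: "(\<lambda>x. 0) \<in> C0 X"
  by (simp add: C0_def)

lemma C0_add:
  assumes "f \<in> C0 X" "g \<in> C0 X"
  shows "f + g \<in> C0 X"
proof (rule C0_I)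
  show "continuous_map X euclideanreal (f + g)"
    using assms by (auto simp: C0_def plus_fun_def intro!: continuous_map_add)
  fix e :: real assume "0 < e"
  then have "0 < e/2" by simp
  then have "compactin X ({x \<in> topspace X. e/2 \<le> \<bar>f x\<bar>} \<union> {x \<in> topspace X. e/2 \<le> \<bar>g x\<bar>})"
    (is "compactin X ?K")
    using assms by (intro compactin_Un C0_compactin)
  moreover have "{x \<in> topspace X. e \<le> \<bar>(f + g) x\<bar>} \<subseteq> ?K"
    by auto
  ultimately show "\<exists>K. compactin X K \<and> {x \<in> topspace X. e \<le> \<bar>(f + g) x\<bar>} \<subseteq> K"
    by blast
qed (use assms in \<open>auto simp: C0_def\<close>)

lemma C0_scale:
  assumes f: "f \<in> C0 X"
  shows "(\<lambda>x. c * f x) \<in> C0 X"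
proof (cases "c = 0")
  case False
  show ?thesis
  proof (rule C0_I)
    show "continuous_map X euclideanreal (\<lambda>x. c * f x)"
      using f by (auto simp: C0_def intro!: continuous_map_real_mult)
    fix e :: real assume "0 < e"
    with False have "compactin X {x \<in> topspace X. e / \<bar>c\<bar> \<le> \<bar>f x\<bar>}"
      using f by (auto simp: C0_def)
    moreover have "{x \<in> topspace X. e \<le> \<bar>c * f x\<bar>} \<subseteq> {x \<in> topspace X. e / \<bar>c\<bar> \<le> \<bar>f x\<bar>}"
      using False by (auto simp: abs_mult field_simps)
    ultimately show "\<exists>K. compactin X K \<and> {x \<in> topspace X. e \<le> \<bar>c * f x\<bar>} \<subseteq> K"
      by blast
  qed (use f in \<open>auto simp: C0_def\<close>)
qed (simp add: zero_in_C0)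

lemma C0_sum:
  assumes "\<And>i::nat. f i \<in> C0 X"
  shows "(\<lambda>x. \<Sum>i<n. f i x) \<in> C0 X"
proof (induction n)
  case (Suc n)
  then have "(\<lambda>x. \<Sum>i<n. f i x) + f n \<in> C0 X"
    using assms by (intro C0_add)
  then show ?case by (simp add: plus_fun_def)
qed (simp add: zero_in_C0)

text \<open>The approximation is required at every point of the type, not only on
  \<open>topspace X\<close>; this is what forces f to vanish off the space.\<close>

lemma C0_uniform_limit:
  assumes approx: "\<And>e. 0 < e \<Longrightarrow> \<exists>g\<in>C0 X. \<forall>x. \<bar>f x - g x\<bar> < e"
  shows "f \<in> C0 X"
proof (rule C0_I)
  have "\<forall>n. \<exists>g\<in>C0 X. \<forall>x. \<bar>f x - g x\<bar> < inverse (real (Suc n))"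
    using approx by simp
  then obtain g where g: "\<And>n. g n \<in> C0 X" "\<And>n x. \<bar>f x - g n x\<bar> < inverse (real (Suc n))"
    by metis
  \<comment> \<open>The uniform limit theorem is stated for abstract metric spaces; for the metric
    of the type, \<open>Met_TC.mtopology\<close> is \<open>euclideanreal\<close>.\<close>
  have "continuous_map X Met_TC.mtopology f"
  proof (rule Met_TC.continuous_map_uniform_limit_alt[where F = sequentially and f = g])
    show "\<forall>\<^sub>F n in sequentially. continuous_map X Met_TC.mtopology (g n)"
      using g(1) by (simp add: C0_def)
    fix e :: real assume "0 < e"
    then have "\<forall>\<^sub>F n in sequentially. inverse (real (Suc n)) < e"
      using LIMSEQ_inverse_real_of_nat by (rule order_tendstoD(2)[rotated])
    then show "\<forall>\<^sub>F n in sequentially. \<forall>x\<in>topspace X. dist (g n x) (f x) < e"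
      by eventually_elim (use g(2) in \<open>auto simp: dist_real_def abs_minus_commute intro: less_trans\<close>)
  qed auto
  then show "continuous_map X euclideanreal f" by simp
next
  fix e :: real assume e: "0 < e"
  then obtain g where g: "g \<in> C0 X" "\<And>x. \<bar>f x - g x\<bar> < e/2"
    using approx[of "e/2"] by auto
  have "compactin X {x \<in> topspace X. e/2 \<le> \<bar>g x\<bar>}"
    using e by (intro C0_compactin g(1)) simp
  \<comment> \<open>As g is within e/2 of f, |f x| >= e leaves |g x| at least e/2.\<close>
  moreover have "{x \<in> topspace X. e \<le> \<bar>f x\<bar>} \<subseteq> {x \<in> topspace X. e/2 \<le> \<bar>g x\<bar>}"
  proof clarsimp
    fix x assume "e \<le> \<bar>f x\<bar>"
    with g(2)[of x] show "e \<le> \<bar>g x\<bar> * 2" by linarith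
  qed
  ultimately show "\<exists>K. compactin X K \<and> {x \<in> topspace X. e \<le> \<bar>f x\<bar>} \<subseteq> K" by blast
next
  fix x assume x: "x \<notin> topspace X"
  have "\<bar>f x\<bar> < e" if e: "0 < e" for e
  proof -
    obtain g where "g \<in> C0 X" "\<bar>f x - g x\<bar> < e" using approx[OF e] by blast
    with x show ?thesis by (simp add: C0_def)
  qed
  \<comment> \<open>If f x were nonzero, e = |f x| would give |f x| < |f x|.\<close>
  from this[of "\<bar>f x\<bar>"] show "f x = 0" by auto
qed

text \<open>The Weierstrass test makes the partial sums converge uniformly, so they serve as the
  approximants in \<open>C0_uniform_limit\<close>.\<close>

lemma C0_suminf:
  assumes f: "\<And>n. f n \<in> C0 X" and M: "summable M" and fM: "\<And>n x. \<bar>f n x\<bar> \<le> M n"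
  shows "(\<lambda>x. \<Sum>n. f n x) \<in> C0 X"
proof (rule C0_uniform_limit)
  fix e :: real assume "0 < e"
  have "uniform_limit UNIV (\<lambda>n x. \<Sum>i<n. f i x) (\<lambda>x. \<Sum>n. f n x) sequentially"
    using M fM by (intro Weierstrass_m_test) auto
  then obtain n where "\<forall>x. dist (\<Sum>i<n. f i x) (\<Sum>n. f n x) < e"
    using \<open>0 < e\<close> unfolding uniform_limit_iff eventually_sequentially by blast
  then show "\<exists>g\<in>C0 X. \<forall>x. \<bar>(\<Sum>n. f n x) - g x\<bar> < e"
    using C0_sum[of f X n] f by (intro bexI[of _ "\<lambda>x. \<Sum>i<n. f i x"]) (auto simp: dist_real_def abs_minus_commute)
qed

text \<open>The image of the compact set where |f| >= 1 is bounded; at all other points, including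
  those off the space, 1 is a bound.\<close>

lemma C0_bounded:
  assumes f: "f \<in> C0 X"
  obtains M where "\<And>x. \<bar>f x\<bar> \<le> M"
proof -
  have "compactin euclideanreal (f ` {x \<in> topspace X. 1 \<le> \<bar>f x\<bar>})"
    using f by (intro image_compactin[of X]) (auto simp: C0_def)
  then have "bounded (f ` {x \<in> topspace X. 1 \<le> \<bar>f x\<bar>})"
    by (simp add: compact_imp_bounded)
  then obtain M where M: "\<And>x. x \<in> topspace X \<Longrightarrow> 1 \<le> \<bar>f x\<bar> \<Longrightarrow> \<bar>f x\<bar> \<le> M"
    by (auto simp: bounded_real)
  have "\<bar>f x\<bar> \<le> max M 1" for x
    using M[of x] f by (cases "x \<in> topspace X"; cases "1 \<le> \<bar>f x\<bar>") (auto simp: C0_def)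
  then show ?thesis by (rule that)
qed

lemma positive_operator_mono:
  assumes P: "positive_operator (C0 X) B P" and f: "f \<in> C0 X" and g: "g \<in> C0 X" and le: "f \<le> g"
  shows "P f \<le> P g"
proof -
  \<comment> \<open>The difference g - f, written with the two operations under which
    \<open>C0 X\<close> is known to be closed.\<close>
  define h where "h = g + (\<lambda>x. - 1 * f x)"
  have h: "h \<in> C0 X" unfolding h_def by (intro C0_add C0_scale f g)
  moreover have "0 \<le> h" using le by (simp add: h_def le_fun_def)
  ultimately have "0 \<le> P h" using P by (auto simp: positive_operator_def)
  moreover have "g = f + h" by (auto simp: h_def)
  then have "P g = P f + P h"
    using P f h by (auto simp: positive_operator_def linear_operator_def)
  ultimately show ?thesis by simp
qed

lemma positive_operator_C0_bounded:
  assumes P: "positive_operator (C0 X) (C0 Y) P"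
  shows "\<exists>M. \<forall>f\<in>unit_part (C0 X). \<forall>y. P f y \<le> M"
proof (rule ccontr)
  assume "\<not> ?thesis"
  then have "\<forall>n. \<exists>f y. f \<in> unit_part (C0 X) \<and> 4 ^ n < P f y"
    by (simp add: not_le Bex_def)
  then obtain f y where f: "\<And>n. f n \<in> unit_part (C0 X)" and big: "\<And>n::nat. 4 ^ n < P (f n) (y n)"
    by metis
  \<comment> \<open>These weights make the series converge uniformly, yet are small enough in decay
    that the growth 4^n outweighs them.\<close>
  define h where "h n = (\<lambda>x. (1/2) ^ n * f n x)" for n
  have f01: "f n \<in> C0 X" "0 \<le> f n x" "f n x \<le> 1" for n x
    using f[of n] by (auto simp: unit_part_C0 le_fun_def)
  have h0: "0 \<le> h n x" and h1: "\<bar>h n x\<bar> \<le> (1/2) ^ n" for n x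
    using f01(2,3)[of n x] by (simp_all add: h_def mult_left_le abs_mult)
  have hC: "h n \<in> C0 X" for n
    unfolding h_def by (intro C0_scale f01)
  have geom: "summable (\<lambda>n. (1/2) ^ n :: real)" by (simp add: summable_geometric)
  define F where "F = (\<lambda>x. \<Sum>n. h n x)"
  have FC: "F \<in> C0 X" unfolding F_def using hC geom h1 by (rule C0_suminf)
  have "h n \<le> F" for n
  proof (rule le_funI)
    fix x
    have "summable (\<lambda>n. h n x)" using h1 by (intro summable_comparison_test'[OF geom, of 0]) simp
    \<comment> \<open>All terms are nonnegative, so a single term is at most the whole
      series.\<close>
    then have "sum (\<lambda>n. h n x) {n} \<le> (\<Sum>n. h n x)" using h0 by (intro sum_le_suminf) auto
    then show "h n x \<le> F x" by (simp add: F_def)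
  qed
  then have le: "P (h n) \<le> P F" for n
    by (rule positive_operator_mono[OF P hC FC])
  \<comment> \<open>The single function \<open>P F\<close> dominates every \<open>P (h n)\<close>,
    so its bound M must exceed every 2^n.\<close>
  have "P F \<in> C0 Y" using P FC by (auto simp: positive_operator_def linear_operator_def)
  then obtain M where M: "\<And>y. \<bar>P F y\<bar> \<le> M" by (rule C0_bounded) blast
  obtain n where n: "M < 2 ^ n" using real_arch_pow[of 2 M] by auto
  have "P (h n) = (\<lambda>y. (1/2) ^ n * P (f n) y)"
    using P f01(1)[of n] by (simp add: h_def positive_operator_def linear_operator_def)
  then have "(1/2) ^ n * P (f n) (y n) \<le> M"
    using le_funD[OF le[of n], of "y n"] M[of "y n"] by simp
  moreover have "(1/2) ^ n * 4 ^ n = (2::real) ^ n"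
    using power_mult_distrib[of "1/2" "4::real" n] by simp
  moreover have "(1/2) ^ n * 4 ^ n < (1/2) ^ n * P (f n) (y n)"
    using big[of n] by (intro mult_strict_left_mono) auto
  ultimately show False using n by simp
qed

text \<open>For c >= 0 an order interval [a, b] is mapped into [c a, c b]. Disjointness is
  pointwise: at each point one of the two functions vanishes, and scaling keeps that zero.\<close>

lemma scale_in_Orth_C0:
  assumes "0 \<le> c"
  shows "(\<lambda>g x. c * g x) \<in> Orth (C0 Y)"
proof -
  have "linear_operator (C0 Y) (C0 Y) (\<lambda>g x. c * g x)"
    by (auto simp: linear_operator_def C0_scale fun_eq_iff algebra_simps)
  then have "order_bounded_operator (C0 Y) (C0 Y) (\<lambda>g x. c * g x)"
    unfolding order_bounded_operator_def
    using assms C0_scale by (auto simp: le_fun_def intro!: bexI mult_left_mono)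
  moreover have "inf (modulus (\<lambda>x. c * f x)) (modulus g) = 0"
    if "inf (modulus f) (modulus g) = 0" for f g :: "'a \<Rightarrow> real"
  proof
    fix x
    have "min \<bar>f x\<bar> \<bar>g x\<bar> = 0"
      using fun_cong[OF that, of x] by (simp add: modulus_apply inf_real_def)
    then show "inf (modulus (\<lambda>x. c * f x)) (modulus g) x = 0 x"
      by (cases "f x = 0"; cases "g x = 0") (auto simp: modulus_apply inf_real_def min_def split: if_splits)
  qed
  ultimately show ?thesis by (simp add: Orth_def)
qed

theorem proposition3:
  fixes X :: "'a topology" and Y :: "'b topology"
    and T :: "('a \<Rightarrow> real) \<Rightarrow> 'b \<Rightarrow> real"
  assumes "locally_compact_space X" and "Hausdorff_space X"
    and "locally_compact_space Y" and "Hausdorff_space Y"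
    and "T \<in> regular_operators (C0 X) (C0 Y)"
    and "separating (C0 X) T"
  shows "almost_contractive (C0 X) (C0 Y) T"
proof -
  obtain P Q where P: "positive_operator (C0 X) (C0 Y) P" and Q: "positive_operator (C0 X) (C0 Y) Q"
    and T: "\<And>f. f \<in> C0 X \<Longrightarrow> T f = P f - Q f"
    using assms(5) by (auto simp: regular_operators_def)
  obtain M N where M: "\<And>f y. f \<in> unit_part (C0 X) \<Longrightarrow> P f y \<le> M"
    and N: "\<And>f y. f \<in> unit_part (C0 X) \<Longrightarrow> Q f y \<le> N"
    using positive_operator_C0_bounded[OF P] positive_operator_C0_bounded[OF Q] by blast
  \<comment> \<open>The 0 secures the sign needed for \<open>scale_in_Orth_C0\<close>.\<close>
  define c where "c = max 0 (max M N)"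
  have "\<bar>T f y\<bar> \<le> c" if f: "f \<in> unit_part (C0 X)" for f y
  proof -
    \<comment> \<open>Two numbers in [0, c] differ by at most c, so upper bounds on
      \<open>P f\<close> and \<open>Q f\<close> control |T f|.\<close>
    have "0 \<le> P f y" "0 \<le> Q f y"
      using f P Q by (auto simp: unit_part_def positive_operator_def le_fun_def)
    then show ?thesis
      using M[OF f, of y] N[OF f, of y] T[of f] f by (auto simp: c_def unit_part_def)
  qed
  then have "\<forall>f\<in>unit_part (C0 X). orth_le (C0 Y) ((*) (modulus (T f))) (\<lambda>g y. c * g y)"
    by (auto simp: orth_le_def le_fun_def modulus_apply intro!: mult_right_mono)
  moreover have "(\<lambda>g y. c * g y) \<in> Orth (C0 Y)"
    by (rule scale_in_Orth_C0) (simp add: c_def)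
  ultimately show ?thesis unfolding almost_contractive_def by blast
qed

end
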